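(* The Lipschitz MAB problem on any infinite metric space is not $(\log t)$-tractable.
   Context: Lipschitz MAB problem on a metric space $(X,\mathcal{D})$ (of diameter at most $1$): $(X,\mathcal{D})$ is known to the algorithm. A problem instance $I$ consists of an unknown payoff function $\mu:X\to[0,1]$ with $|\mu(x)-\mu(y)|\le\mathcal{D}(x,y)$ for all $x,y$, and for each $x$ a distribution on $[0,1]$ with mean $\mu(x)$. In each round $t$ the algorithm picks $x_t\in X$ and receives an independent reward from the distribution of $x_t$. Regret: $R(t)=t\sup_x\mu(x)-\mathbb{E}[\sum_{s\le t}\mu(x_s)]$. The problem is $f(t)$-tractable if there is an algorithm such that for every instance $I$ there is a constant $C_I$ with $R(t)\le C_I f(t)$ for all $t$. *)

theory Defs
  imports "HOL-Probability.Probability"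
begin

text \<open>
  The metric space of arms is a type of class \<^class>\<open>metric_space\<close> with its Borel
  sigma-algebra. Rounds are numbered from 0, so the history before round \<open>t\<close> is an element
  of the product space over \<open>{0..<t}\<close> of pairs (arm, reward).
\<close>

abbreviation round_space :: "('a::metric_space \<times> real) measure" where
  "round_space \<equiv> borel \<Otimes>\<^sub>M borel"

abbreviation history_space :: "nat \<Rightarrow> (nat \<Rightarrow> 'a::metric_space \<times> real) measure" where
  "history_space t \<equiv> PiM {0..<t} (\<lambda>_. round_space)"

text \<open>
  A (randomized) algorithm gives, for each round \<open>t\<close>, a probability kernel from histories to
  arms. Deterministic algorithms are the case of point masses.
\<close>

type_synonym 'a mab_algorithm = "nat \<Rightarrow> (nat \<Rightarrow> 'a \<times> real) \<Rightarrow> 'a measure"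

definition mab_algorithm :: "'a::metric_space mab_algorithm \<Rightarrow> bool" where
  "mab_algorithm A \<longleftrightarrow> (\<forall>t. A t \<in> history_space t \<rightarrow>\<^sub>M prob_algebra borel)"

text \<open>
  \<open>P x\<close> is the reward distribution of arm \<open>x\<close>. Measurability of \<open>P\<close> is what makes the joint
  law of arms and rewards well defined.
\<close>

definition lipschitz_mab_instance ::
    "('a::metric_space \<Rightarrow> real) \<Rightarrow> ('a \<Rightarrow> real measure) \<Rightarrow> bool" where
  "lipschitz_mab_instance \<mu> P \<longleftrightarrow>
     (\<forall>x. 0 \<le> \<mu> x \<and> \<mu> x \<le> 1) \<and>
     (\<forall>x y. \<bar>\<mu> x - \<mu> y\<bar> \<le> dist x y) \<and>
     P \<in> borel \<rightarrow>\<^sub>M prob_algebra borel \<and>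
     (\<forall>x. (AE r in P x. r \<in> {0..1}) \<and> (\<integral>r. r \<partial>P x) = \<mu> x)"

definition round_law ::
    "'a::metric_space mab_algorithm \<Rightarrow> ('a \<Rightarrow> real measure) \<Rightarrow> nat \<Rightarrow> (nat \<Rightarrow> 'a \<times> real) \<Rightarrow>
      ('a \<times> real) measure" where
  "round_law A P t h = A t h \<bind> (\<lambda>x. distr (P x) round_space (\<lambda>r. (x, r)))"

primrec history_law ::
    "'a::metric_space mab_algorithm \<Rightarrow> ('a \<Rightarrow> real measure) \<Rightarrow> nat \<Rightarrow>
      (nat \<Rightarrow> 'a \<times> real) measure" where
  "history_law A P 0 = return (history_space 0) (\<lambda>_. undefined)"
| "history_law A P (Suc t) = history_law A P t \<bind>
     (\<lambda>h. distr (round_law A P t h) (history_space (Suc t)) (\<lambda>z. h(t := z)))"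

definition regret ::
    "'a::metric_space mab_algorithm \<Rightarrow> ('a \<Rightarrow> real) \<Rightarrow> ('a \<Rightarrow> real measure) \<Rightarrow> nat \<Rightarrow> real" where
  "regret A \<mu> P t =
     real t * (SUP x. \<mu> x) - (\<integral>h. (\<Sum>s<t. \<mu> (fst (h s))) \<partial>history_law A P t)"

text \<open>
  The bound is imposed for \<open>t \<ge> 2\<close> because \<open>ln 1 = 0\<close>: at \<open>t = 1\<close> the case \<open>f = ln\<close> would demand
  that the very first arm be optimal, whatever the instance, and would make the failure of
  tractability trivial. For positive \<open>f\<close> the bound for all \<open>t \<ge> 1\<close> is the same notion, since
  one can enlarge \<open>C\<close>.
\<close>

definition lipschitz_mab_tractable :: "'a::metric_space itself \<Rightarrow> (nat \<Rightarrow> real) \<Rightarrow> bool" where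
  "lipschitz_mab_tractable _ f \<longleftrightarrow>
     (\<exists>A :: 'a mab_algorithm. mab_algorithm A \<and>
        (\<forall>\<mu> P. lipschitz_mab_instance \<mu> P \<longrightarrow>
           (\<exists>C. \<forall>t\<ge>2. regret A \<mu> P t \<le> C * f t)))"

end

theory Submission
  imports Defs "HOL-Real_Asymp.Real_Asymp"
begin

text \<open>
  An infinite metric space contains points \<open>x n\<close> and radii \<open>r n > 0\<close> such that \<open>x m\<close> is at distance
  at least \<open>r n\<close> from \<open>x n\<close> for \<open>m \<noteq> n\<close>. Take Bernoulli rewards with a payoff function that equals \<open>1/2\<close>
  except for a dip of depth of order \<open>r n\<close> at each \<open>x n\<close> with \<open>n \<ge> 1\<close>. For each such \<open>n\<close> there is a
  second instance, which differs only on \<open>B n = ball (x n) (r n / 2)\<close>, where a bump makes \<open>x n\<close> better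
  than everything outside \<open>B n\<close> by \<open>r n / 8\<close>.

  As in the Lai--Robbins lower bound, logarithmic regret on both instances forces order of
  \<open>ln t / r n\<close> expected pulls in \<open>B n\<close> on the base instance. Each of these costs at least \<open>r n / 8\<close>, so
  every \<open>n\<close> contributes at least a fixed multiple of \<open>ln t\<close> to the regret of the base instance, and
  there are infinitely many \<open>n\<close>.

  No Kullback--Leibler divergence is needed for this: a single reward in \<open>B n\<close> lowers the likelihood
  ratio at most by the factor \<open>exp (- 3 * r n)\<close>, and this crude pointwise bound, linear in \<open>r n\<close>,
  already suffices.
\<close>

section \<open>Measurability and the law of the history\<close>

lemma borel_measurable_lipschitz_real:
  fixes f :: "'a::metric_space \<Rightarrow> real"
  assumes "\<And>x y. \<bar>f x - f y\<bar> \<le> dist x y"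
  shows "f \<in> borel_measurable borel"
proof (rule borel_measurable_continuous_onI)
  have "1-lipschitz_on UNIV f"
    using assms by (intro lipschitz_onI) (auto simp: dist_real_def)
  then show "continuous_on UNIV f"
    by (rule lipschitz_on_continuous_on)
qed

lemma measurable_pair_reward:
  assumes "P \<in> borel \<rightarrow>\<^sub>M prob_algebra borel"
  shows "(\<lambda>x::'a::metric_space. distr (P x) round_space (\<lambda>r::real. (x, r)))
    \<in> borel \<rightarrow>\<^sub>M prob_algebra round_space"
  using assms by (rule measurable_distr_prob_space2) simp

lemma measurable_round_law:
  fixes A :: "'a::metric_space mab_algorithm"
  assumes "mab_algorithm A" "P \<in> borel \<rightarrow>\<^sub>M prob_algebra borel"
  shows "round_law A P t \<in> history_space t \<rightarrow>\<^sub>M prob_algebra round_space"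
proof -
  have "A t \<in> history_space t \<rightarrow>\<^sub>M prob_algebra borel"
    using assms(1) by (simp add: mab_algorithm_def)
  then show ?thesis
    unfolding round_law_def[abs_def]
    by (rule measurable_bind_prob_space[OF _ measurable_pair_reward[OF assms(2)]])
qed

lemma measurable_extend_history:
  "(\<lambda>(h, z). h(t := z)) \<in> history_space t \<Otimes>\<^sub>M round_space \<rightarrow>\<^sub>M history_space (Suc t)"
  using measurable_add_dim[of t "{0..<t}" "\<lambda>_. round_space"]
  by (simp add: atLeast0_lessThan_Suc)

lemma measurable_extend_history_law:
  fixes A :: "'a::metric_space mab_algorithm"
  assumes "mab_algorithm A" "P \<in> borel \<rightarrow>\<^sub>M prob_algebra borel"
  shows "(\<lambda>h. distr (round_law A P t h) (history_space (Suc t)) (\<lambda>z. h(t := z)))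
    \<in> history_space t \<rightarrow>\<^sub>M prob_algebra (history_space (Suc t))"
  by (rule measurable_distr_prob_space2[OF measurable_round_law[OF assms] measurable_extend_history])

lemma history_law_in_prob_algebra:
  fixes A :: "'a::metric_space mab_algorithm"
  assumes "mab_algorithm A" "P \<in> borel \<rightarrow>\<^sub>M prob_algebra borel"
  shows "history_law A P t \<in> space (prob_algebra (history_space t))"
proof (induction t)
  case 0
  \<comment> \<open>The product over the empty index set has the single point
    \<open>\<lambda>_. undefined\<close>, so the initial point mass lives on the right
    space.\<close>
  show ?case
    by (auto simp: space_prob_algebra space_PiM intro!: prob_space_return)
next
  case (Suc t)
  show ?case
    using prob_space_bind'[OF Suc measurable_extend_history_law[OF assms]]
      sets_bind'[OF Suc measurable_extend_history_law[OF assms]]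
    by (simp add: space_prob_algebra)
qed

lemma prob_space_history_law:
  fixes A :: "'a::metric_space mab_algorithm"
  assumes "mab_algorithm A" "P \<in> borel \<rightarrow>\<^sub>M prob_algebra borel"
  shows "prob_space (history_law A P t)"
  using history_law_in_prob_algebra[OF assms] by (simp add: space_prob_algebra)

lemma sets_history_law:
  fixes A :: "'a::metric_space mab_algorithm"
  assumes "mab_algorithm A" "P \<in> borel \<rightarrow>\<^sub>M prob_algebra borel"
  shows "sets (history_law A P t) = sets (history_space t)"
  using history_law_in_prob_algebra[OF assms] by (simp add: space_prob_algebra)

text \<open>Resolves the binds hidden in \<open>history_law\<close> and \<open>round_law\<close>:
  the last round becomes an inner integral, first over the arm, then over its reward. Inductions
  over the number of rounds rest on this form.\<close>

lemma nn_integral_history_law_Suc: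
  fixes A :: "'a::metric_space mab_algorithm"
  assumes A: "mab_algorithm A" and P: "P \<in> borel \<rightarrow>\<^sub>M prob_algebra borel"
    and f: "f \<in> borel_measurable (history_space (Suc t))"
  shows "(\<integral>\<^sup>+h. f h \<partial>history_law A P (Suc t)) =
    (\<integral>\<^sup>+h. (\<integral>\<^sup>+x. (\<integral>\<^sup>+r. f (h(t := (x, r))) \<partial>P x) \<partial>A t h) \<partial>history_law A P t)"
proof -
  have sets: "sets (history_law A P t) = sets (history_space t)"
    by (rule sets_history_law[OF A P])
  have space: "space (history_law A P t) = space (history_space t)"
    by (rule sets_eq_imp_space_eq[OF sets])
  have At: "A t \<in> history_space t \<rightarrow>\<^sub>M subprob_algebra borel"
    using A by (auto simp: mab_algorithm_def intro: measurable_prob_algebraD)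
  note P' = measurable_prob_algebraD[OF P]
  have "(\<integral>\<^sup>+h. f h \<partial>history_law A P (Suc t)) =
      (\<integral>\<^sup>+h. (\<integral>\<^sup>+h'. f h' \<partial>distr (round_law A P t h) (history_space (Suc t)) (\<lambda>z. h(t := z)))
        \<partial>history_law A P t)"
    unfolding history_law.simps
  proof (rule nn_integral_bind[OF f])
    show "(\<lambda>h. distr (round_law A P t h) (history_space (Suc t)) (\<lambda>z. h(t := z)))
      \<in> history_law A P t \<rightarrow>\<^sub>M subprob_algebra (history_space (Suc t))"
      using measurable_prob_algebraD[OF measurable_extend_history_law[OF A P]]
      by (simp add: measurable_cong_sets[OF sets refl])
  qed
  also have "\<dots> = (\<integral>\<^sup>+h. (\<integral>\<^sup>+x. (\<integral>\<^sup>+r. f (h(t := (x, r))) \<partial>P x) \<partial>A t h) \<partial>history_law A P t)"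
  proof (rule nn_integral_cong)
    fix h assume "h \<in> space (history_law A P t)"
    then have h: "h \<in> space (history_space t)" by (simp add: space)
    have ext: "(\<lambda>z. h(t := z)) \<in> round_space \<rightarrow>\<^sub>M history_space (Suc t)"
      using measurable_compose[OF measurable_Pair1'[OF h] measurable_extend_history[of t]]
      by simp
    have fext: "(\<lambda>z. f (h(t := z))) \<in> borel_measurable round_space"
      by (rule measurable_compose[OF ext f])
    note sr = subprob_measurableD[OF measurable_prob_algebraD[OF measurable_round_law[OF A P, of t]] h]
    note sA = subprob_measurableD[OF At h]
    have "(\<integral>\<^sup>+h'. f h' \<partial>distr (round_law A P t h) (history_space (Suc t)) (\<lambda>z. h(t := z))) =
        (\<integral>\<^sup>+z. f (h(t := z)) \<partial>round_law A P t h)"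
      by (rule nn_integral_distr) (use ext f in \<open>simp_all add: sr\<close>)
    also have "\<dots> = (\<integral>\<^sup>+x. (\<integral>\<^sup>+z. f (h(t := z)) \<partial>distr (P x) round_space (\<lambda>r. (x, r))) \<partial>A t h)"
      unfolding round_law_def
      by (rule nn_integral_bind[OF fext])
        (use measurable_prob_algebraD[OF measurable_pair_reward[OF P]] in \<open>simp add: sA\<close>)
    also have "\<dots> = (\<integral>\<^sup>+x. (\<integral>\<^sup>+r. f (h(t := (x, r))) \<partial>P x) \<partial>A t h)"
    proof (rule nn_integral_cong)
      fix x
      note sP = subprob_measurableD[OF P', of x, simplified]
      show "(\<integral>\<^sup>+z. f (h(t := z)) \<partial>distr (P x) round_space (\<lambda>r. (x, r))) =
          (\<integral>\<^sup>+r. f (h(t := (x, r))) \<partial>P x)"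
        by (rule nn_integral_distr) (use fext in \<open>simp_all add: sP\<close>)
    qed
    finally show "(\<integral>\<^sup>+h'. f h' \<partial>distr (round_law A P t h) (history_space (Suc t)) (\<lambda>z. h(t := z))) =
        (\<integral>\<^sup>+x. (\<integral>\<^sup>+r. f (h(t := (x, r))) \<partial>P x) \<partial>A t h)" .
  qed
  finally show ?thesis .
qed

section \<open>Change of measure between two reward kernels\<close>

lemma measurable_history_arm:
  assumes "s < t"
  shows "(\<lambda>h. fst (h s)) \<in> history_space t \<rightarrow>\<^sub>M (borel :: 'a::metric_space measure)"
proof -
  have "(\<lambda>h. h s) \<in> history_space t \<rightarrow>\<^sub>M round_space"
    using assms by (intro measurable_component_singleton) simp
  then show ?thesis
    by (rule measurable_compose[OF _ measurable_fst])
qed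

text \<open>The algorithm reacts to a given history in the same way under \<open>P\<close> and
  \<open>P'\<close>, so the two laws differ only through the rewards, and the one-round bounds
  \<open>dom\<close> multiply along the history. A lower bound \<open>w\<close> depending on the arm
  alone replaces the likelihood ratio, so no densities have to be chosen. The induction varies
  \<open>f\<close>, because integrating out the last round produces a new test function.\<close>

lemma history_law_dominated:
  fixes A :: "'a::metric_space mab_algorithm" and w :: "'a \<Rightarrow> ennreal"
  assumes A: "mab_algorithm A" and P: "P \<in> borel \<rightarrow>\<^sub>M prob_algebra borel"
    and P': "P' \<in> borel \<rightarrow>\<^sub>M prob_algebra borel"
    and w: "w \<in> borel_measurable borel"
    and dom: "\<And>x g. g \<in> borel_measurable borel \<Longrightarrow> w x * (\<integral>\<^sup>+r. g r \<partial>P x) \<le> (\<integral>\<^sup>+r. g r \<partial>P' x)"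
    and f: "f \<in> borel_measurable (history_space t)"
  shows "(\<integral>\<^sup>+h. f h * (\<Prod>s<t. w (fst (h s))) \<partial>history_law A P t) \<le> (\<integral>\<^sup>+h. f h \<partial>history_law A P' t)"
  using f
proof (induction t arbitrary: f)
  case 0
  then show ?case by simp
next
  case (Suc t)
  note f = Suc.prems
  have sets: "sets (history_law A Q t) = sets (history_space t)"
    if "Q \<in> borel \<rightarrow>\<^sub>M prob_algebra borel" for Q
    by (rule sets_history_law[OF A that])
  have At: "A t \<in> history_space t \<rightarrow>\<^sub>M subprob_algebra borel"
    using A by (auto simp: mab_algorithm_def intro: measurable_prob_algebraD)
  let ?W = "\<lambda>t h. \<Prod>s<t. w (fst (h s))"
  have W: "?W t \<in> borel_measurable (history_space t)" for t
    by (intro borel_measurable_prod_ennreal measurable_compose[OF measurable_history_arm w]) auto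
  \<comment> \<open>\<open>?F\<close> is \<open>f\<close> with round \<open>t\<close> integrated out
    under \<open>P'\<close>. It is the test function for the induction hypothesis, hence the need
    for its joint measurability.\<close>
  let ?F = "\<lambda>h. \<integral>\<^sup>+x. (\<integral>\<^sup>+r. f (h(t := (x, r))) \<partial>P' x) \<partial>A t h"
  have ext: "(\<lambda>(h, x, r). f (h(t := (x, r)))) \<in>
      borel_measurable (history_space t \<Otimes>\<^sub>M round_space)"
    using measurable_compose[OF measurable_extend_history f] by (simp only: case_prod_unfold prod.collapse)
  have "(\<lambda>((h, x), r). f (h(t := (x, r)))) \<in>
      borel_measurable ((history_space t \<Otimes>\<^sub>M borel) \<Otimes>\<^sub>M borel)"
  proof -
    have "(\<lambda>y. (fst (fst y), (snd (fst y), snd y))) \<in>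
      (history_space t \<Otimes>\<^sub>M borel) \<Otimes>\<^sub>M borel \<rightarrow>\<^sub>M history_space t \<Otimes>\<^sub>M (borel \<Otimes>\<^sub>M borel)"
      by measurable
    from measurable_compose[OF this ext] show ?thesis by (simp add: case_prod_unfold)
  qed
  then have "(\<lambda>(h, x). \<integral>\<^sup>+r. f (h(t := (x, r))) \<partial>P' x) \<in>
      borel_measurable (history_space t \<Otimes>\<^sub>M borel)"
    using nn_integral_measurable_subprob_algebra2[of "\<lambda>y r. f ((fst y)(t := (snd y, r)))"
        "history_space t \<Otimes>\<^sub>M borel" borel "\<lambda>y. P' (snd y)"]
      measurable_compose[OF measurable_snd[of "history_space t"] measurable_prob_algebraD[OF P']]
    by (simp add: case_prod_unfold)
  from nn_integral_measurable_subprob_algebra2[OF this At]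
  have F: "?F \<in> borel_measurable (history_space t)" .
  \<comment> \<open>Writing to position \<open>t\<close> leaves the earlier rounds alone, so the
    weight splits off one factor for the new arm, to which \<open>dom\<close> applies.\<close>
  have W_ext: "?W (Suc t) (h(t := z)) = ?W t h * w (fst z)" for h z
    by simp
  have "(\<integral>\<^sup>+h. f h * ?W (Suc t) h \<partial>history_law A P (Suc t)) =
      (\<integral>\<^sup>+h. (\<integral>\<^sup>+x. (\<integral>\<^sup>+r. f (h(t := (x, r))) * ?W (Suc t) (h(t := (x, r))) \<partial>P x) \<partial>A t h)
        \<partial>history_law A P t)"
    by (rule nn_integral_history_law_Suc[OF A P]) (intro borel_measurable_times_ennreal f W)
  also have "\<dots> \<le> (\<integral>\<^sup>+h. ?F h * ?W t h \<partial>history_law A P t)"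
  proof (rule nn_integral_mono)
    fix h assume "h \<in> space (history_law A P t)"
    then have h: "h \<in> space (history_space t)"
      using sets_eq_imp_space_eq[OF sets[OF P]] by simp
    have fx: "(\<lambda>r. f (h(t := (x, r)))) \<in> borel_measurable borel" for x
    proof -
      have "(\<lambda>r. (h, (x, r))) \<in> borel \<rightarrow>\<^sub>M history_space t \<Otimes>\<^sub>M round_space"
        using h by (intro measurable_Pair) auto
      from measurable_compose[OF this ext] show ?thesis by simp
    qed
    have "(\<integral>\<^sup>+r. f (h(t := (x, r))) * ?W (Suc t) (h(t := (x, r))) \<partial>P x) \<le>
        (\<integral>\<^sup>+r. f (h(t := (x, r))) \<partial>P' x) * ?W t h" for x
    proof -
      have fx': "(\<lambda>r. f (h(t := (x, r)))) \<in> borel_measurable (P x)"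
        using fx subprob_measurableD[OF measurable_prob_algebraD[OF P], of x] by simp
      have "(\<integral>\<^sup>+r. f (h(t := (x, r))) * ?W (Suc t) (h(t := (x, r))) \<partial>P x) =
          ?W t h * (w x * (\<integral>\<^sup>+r. f (h(t := (x, r))) \<partial>P x))"
        unfolding W_ext fst_conv nn_integral_multc[OF fx'] by (simp only: mult_ac)
      also have "\<dots> \<le> ?W t h * (\<integral>\<^sup>+r. f (h(t := (x, r))) \<partial>P' x)"
        by (intro mult_left_mono dom fx) auto
      finally show ?thesis by (simp only: mult.commute)
    qed
    then have "(\<integral>\<^sup>+x. (\<integral>\<^sup>+r. f (h(t := (x, r))) * ?W (Suc t) (h(t := (x, r))) \<partial>P x) \<partial>A t h) \<le>
        (\<integral>\<^sup>+x. (\<integral>\<^sup>+r. f (h(t := (x, r))) \<partial>P' x) * ?W t h \<partial>A t h)"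
      by (intro nn_integral_mono)
    also have "\<dots> = ?F h * ?W t h"
    proof (rule nn_integral_multc)
      have "(\<lambda>(x, r). f (h(t := (x, r)))) \<in> borel_measurable (borel \<Otimes>\<^sub>M borel)"
        using measurable_compose[OF measurable_Pair1'[OF h] ext] by simp
      from nn_integral_measurable_subprob_algebra2[OF this measurable_prob_algebraD[OF P']]
      show "(\<lambda>x. \<integral>\<^sup>+r. f (h(t := (x, r))) \<partial>P' x) \<in> borel_measurable (A t h)"
        by (simp add: subprob_measurableD[OF At h])
    qed
    finally show "(\<integral>\<^sup>+x. (\<integral>\<^sup>+r. f (h(t := (x, r))) * ?W (Suc t) (h(t := (x, r))) \<partial>P x) \<partial>A t h) \<le>
        ?F h * ?W t h" .
  qed
  also have "\<dots> \<le> (\<integral>\<^sup>+h. ?F h \<partial>history_law A P' t)"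
    by (rule Suc.IH[OF F])
  also have "\<dots> = (\<integral>\<^sup>+h. f h \<partial>history_law A P' (Suc t))"
    by (rule nn_integral_history_law_Suc[OF A P' f, symmetric])
  finally show ?case .
qed

section \<open>Bernoulli rewards\<close>

definition bernoulli_reward :: "('a \<Rightarrow> real) \<Rightarrow> 'a \<Rightarrow> real measure" where
  "bernoulli_reward \<mu> x = distr (measure_pmf (bernoulli_pmf (\<mu> x))) borel of_bool"

lemma nn_integral_bernoulli_reward:
  assumes "0 \<le> \<mu> x" "\<mu> x \<le> 1" "g \<in> borel_measurable borel"
  shows "(\<integral>\<^sup>+r. g r \<partial>bernoulli_reward \<mu> x) = g 1 * ennreal (\<mu> x) + g 0 * ennreal (1 - \<mu> x)"
  using assms unfolding bernoulli_reward_def by (subst nn_integral_distr) auto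

lemma lipschitz_mab_instance_bernoulli_reward:
  fixes \<mu> :: "'a::metric_space \<Rightarrow> real"
  assumes range: "\<And>x. 0 \<le> \<mu> x" "\<And>x. \<mu> x \<le> 1"
    and lip: "\<And>x y. \<bar>\<mu> x - \<mu> y\<bar> \<le> dist x y"
  shows "lipschitz_mab_instance \<mu> (bernoulli_reward \<mu>)"
proof -
  have \<mu>: "\<mu> \<in> borel_measurable borel"
    by (rule borel_measurable_lipschitz_real[OF lip])
  have "prob_space (bernoulli_reward \<mu> x)" for x
    unfolding bernoulli_reward_def by (rule measure_pmf.prob_space_distr) simp
  moreover have "bernoulli_reward \<mu> \<in> borel \<rightarrow>\<^sub>M subprob_algebra borel"
  proof (rule measurable_subprob_algebra)
    fix B :: "real set" assume B: "B \<in> sets borel"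
    \<comment> \<open>The probability of a fixed set is affine in \<open>\<mu> x\<close>, so the
      kernel inherits measurability from the continuity of \<open>\<mu>\<close>.\<close>
    have "emeasure (bernoulli_reward \<mu> x) B =
        indicator B 1 * ennreal (\<mu> x) + indicator B 0 * ennreal (1 - \<mu> x)" for x
    proof -
      have "emeasure (bernoulli_reward \<mu> x) B = (\<integral>\<^sup>+r. indicator B r \<partial>bernoulli_reward \<mu> x)"
        using B by (simp add: bernoulli_reward_def)
      also have "\<dots> = indicator B 1 * ennreal (\<mu> x) + indicator B 0 * ennreal (1 - \<mu> x)"
        using B range by (intro nn_integral_bernoulli_reward) auto
      finally show ?thesis .
    qed
    then show "(\<lambda>x. emeasure (bernoulli_reward \<mu> x) B) \<in> borel_measurable borel"
      using \<mu> by simp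
  qed (use calculation in \<open>auto simp: bernoulli_reward_def intro: prob_space_imp_subprob_space\<close>)
  ultimately have "bernoulli_reward \<mu> \<in> borel \<rightarrow>\<^sub>M prob_algebra borel"
    by (intro measurable_prob_algebraI) auto
  moreover have "AE r in bernoulli_reward \<mu> x. r \<in> {0..1}" for x
    unfolding bernoulli_reward_def by (subst AE_distr_iff) auto
  moreover have "(\<integral>r. r \<partial>bernoulli_reward \<mu> x) = \<mu> x" for x
    unfolding bernoulli_reward_def using range by (subst integral_distr) auto
  ultimately show ?thesis
    using range lip by (simp add: lipschitz_mab_instance_def)
qed

text \<open>Both laws are carried by the atoms 0 and 1, so it suffices to compare the two masses.
  This supplies the domination hypothesis of the change of measure.\<close>

lemma nn_integral_bernoulli_reward_mono:
  assumes p: "0 \<le> \<mu> x" "\<mu> x \<le> 1" and q: "0 \<le> \<nu> x" "\<nu> x \<le> 1" and c: "0 \<le> c"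
    and le: "c * \<mu> x \<le> \<nu> x" "c * (1 - \<mu> x) \<le> 1 - \<nu> x" and g: "g \<in> borel_measurable borel"
  shows "ennreal c * (\<integral>\<^sup>+r. g r \<partial>bernoulli_reward \<mu> x) \<le> (\<integral>\<^sup>+r. g r \<partial>bernoulli_reward \<nu> x)"
proof -
  have "ennreal c * (\<integral>\<^sup>+r. g r \<partial>bernoulli_reward \<mu> x) =
      g 1 * ennreal (c * \<mu> x) + g 0 * ennreal (c * (1 - \<mu> x))"
    using p c by (simp add: nn_integral_bernoulli_reward[of \<mu> x, OF p g] ennreal_mult distrib_left mult_ac)
  also have "\<dots> \<le> g 1 * ennreal (\<nu> x) + g 0 * ennreal (1 - \<nu> x)"
    using le by (intro add_mono mult_left_mono ennreal_leI) auto
  also have "\<dots> = (\<integral>\<^sup>+r. g r \<partial>bernoulli_reward \<nu> x)"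
    by (rule nn_integral_bernoulli_reward[of \<nu> x, OF q g, symmetric])
  finally show ?thesis .
qed

section \<open>Pull counts and lower bounds on the regret\<close>

definition pulls :: "'a set \<Rightarrow> nat \<Rightarrow> (nat \<Rightarrow> 'a \<times> real) \<Rightarrow> real" where
  "pulls B t h = (\<Sum>s<t. indicator B (fst (h s)))"

lemma pulls_nonneg: "0 \<le> pulls B t h"
  unfolding pulls_def by (intro sum_nonneg) auto

lemma pulls_le: "pulls B t h \<le> real t"
proof -
  have "pulls B t h \<le> (\<Sum>s<t. 1)"
    unfolding pulls_def by (intro sum_mono) (auto simp: indicator_def)
  then show ?thesis by simp
qed

lemma borel_measurable_sum_arms:
  fixes \<phi> :: "'a::metric_space \<Rightarrow> real"
  assumes "\<phi> \<in> borel_measurable borel"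
  shows "(\<lambda>h. \<Sum>s<t. \<phi> (fst (h s))) \<in> borel_measurable (history_space t)"
  by (intro borel_measurable_sum measurable_compose[OF measurable_history_arm assms]) auto

lemma borel_measurable_pulls:
  fixes B :: "'a::metric_space set"
  assumes "B \<in> sets borel"
  shows "pulls B t \<in> borel_measurable (history_space t)"
  unfolding pulls_def[abs_def] using assms by (intro borel_measurable_sum_arms) simp

lemma integrable_history_law:
  fixes A :: "'a::metric_space mab_algorithm" and f :: "(nat \<Rightarrow> 'a \<times> real) \<Rightarrow> real"
  assumes "mab_algorithm A" "P \<in> borel \<rightarrow>\<^sub>M prob_algebra borel"
    and "f \<in> borel_measurable (history_space t)" and "\<And>h. \<bar>f h\<bar> \<le> C"
  shows "integrable (history_law A P t) f"
proof -
  interpret prob_space "history_law A P t"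
    by (rule prob_space_history_law[OF assms(1,2)])
  show ?thesis
    by (rule integrable_const_bound[of _ C])
      (use assms sets_history_law[OF assms(1,2), of t] in \<open>auto cong: measurable_cong_sets\<close>)
qed

lemma integrable_pulls:
  fixes A :: "'a::metric_space mab_algorithm"
  assumes "mab_algorithm A" "P \<in> borel \<rightarrow>\<^sub>M prob_algebra borel" "B \<in> sets borel"
  shows "integrable (history_law A P t) (pulls B t)"
  by (rule integrable_history_law[OF assms(1,2) borel_measurable_pulls[OF assms(3)], of _ "real t"])
    (simp add: pulls_nonneg pulls_le)

text \<open>Regret is the expected sum of the gaps of the arms played, so each round may be charged
  any amount \<open>\<phi>\<close> below its gap. Later \<open>\<phi>\<close> is a multiple of an
  indicator, or a sum of such multiples.\<close>

lemma integral_gap_le_regret: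
  fixes A :: "'a::metric_space mab_algorithm"
  assumes A: "mab_algorithm A" and I: "lipschitz_mab_instance \<mu> P"
    and \<phi>: "\<phi> \<in> borel_measurable borel" and nonneg: "\<And>x. 0 \<le> \<phi> x"
    and gap: "\<And>x. \<phi> x \<le> (SUP x. \<mu> x) - \<mu> x"
  shows "(\<integral>h. (\<Sum>s<t. \<phi> (fst (h s))) \<partial>history_law A P t) \<le> regret A \<mu> P t"
proof -
  have P: "P \<in> borel \<rightarrow>\<^sub>M prob_algebra borel" and \<mu>: "\<And>x. 0 \<le> \<mu> x" "\<And>x. \<mu> x \<le> 1"
    and lip: "\<And>x y. \<bar>\<mu> x - \<mu> y\<bar> \<le> dist x y"
    using I by (auto simp: lipschitz_mab_instance_def)
  have "\<mu> \<in> borel_measurable borel"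
    by (rule borel_measurable_lipschitz_real[OF lip])
  \<comment> \<open>Gaps are at most 1, hence so is \<open>\<phi>\<close>; the sums over rounds are
    then bounded by \<open>t\<close> and integrable.\<close>
  have S: "(SUP x. \<mu> x) \<le> 1"
    using \<mu> by (intro cSUP_least) auto
  have \<phi>1: "\<phi> x \<le> 1" for x
    using gap[of x] S \<mu>(1)[of x] by linarith
  have bnd: "\<bar>\<Sum>s<t. f (fst (h s))\<bar> \<le> real t" if "\<And>x. 0 \<le> f x" "\<And>x. f x \<le> 1"
    for f :: "'a \<Rightarrow> real" and h :: "nat \<Rightarrow> 'a \<times> real"
  proof -
    have "(\<Sum>s<t. f (fst (h s))) \<le> (\<Sum>s<t. 1)"
      by (intro sum_mono that)
    moreover have "0 \<le> (\<Sum>s<t. f (fst (h s)))"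
      by (intro sum_nonneg that)
    ultimately show ?thesis by simp
  qed
  interpret prob_space "history_law A P t"
    by (rule prob_space_history_law[OF A P])
  have int: "integrable (history_law A P t) (\<lambda>h. \<Sum>s<t. f (fst (h s)))"
    if "f \<in> borel_measurable borel" "\<And>x. 0 \<le> f x" "\<And>x. f x \<le> 1" for f :: "'a \<Rightarrow> real"
    by (rule integrable_history_law[OF A P borel_measurable_sum_arms bnd]) (use that in auto)
  note int\<mu> = int[OF \<open>\<mu> \<in> borel_measurable borel\<close> \<mu>]
  have "(\<integral>h. (\<Sum>s<t. \<phi> (fst (h s))) \<partial>history_law A P t) \<le>
      (\<integral>h. real t * (SUP x. \<mu> x) - (\<Sum>s<t. \<mu> (fst (h s))) \<partial>history_law A P t)"
  proof (rule integral_mono[OF int[OF \<phi> nonneg \<phi>1]])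
    fix h
    have "(\<Sum>s<t. \<phi> (fst (h s))) \<le> (\<Sum>s<t. (SUP x. \<mu> x) - \<mu> (fst (h s)))"
      by (intro sum_mono gap)
    then show "(\<Sum>s<t. \<phi> (fst (h s))) \<le> real t * (SUP x. \<mu> x) - (\<Sum>s<t. \<mu> (fst (h s)))"
      by (simp add: sum_subtractf)
  qed (use int\<mu> in simp)
  also have "\<dots> = regret A \<mu> P t"
    using int\<mu> by (simp add: regret_def prob_space)
  finally show ?thesis .
qed

text \<open>
  With \<open>N\<close> the number of pulls in \<open>B\<close>, the two regrets are at least \<open>\<delta> * E N\<close> and \<open>\<delta> * E' (t - N)\<close>,
  and \<open>E' (t - N) \<ge> E ((t - N) * exp (- \<kappa> * N))\<close>. Hence their sum is at least
  \<open>\<delta> * t * E (exp (- \<kappa> * N))\<close>, and Jensen's inequality applies.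
\<close>

lemma regret_sum_ge:
  fixes A :: "'a::metric_space mab_algorithm"
  assumes A: "mab_algorithm A"
    and I: "lipschitz_mab_instance \<mu> P" and I': "lipschitz_mab_instance \<mu>' P'"
    and B: "B \<in> sets borel" and \<delta>: "0 \<le> \<delta>"
    and gap: "\<And>x. x \<in> B \<Longrightarrow> \<delta> \<le> (SUP x. \<mu> x) - \<mu> x"
    and gap': "\<And>x. x \<notin> B \<Longrightarrow> \<delta> \<le> (SUP x. \<mu>' x) - \<mu>' x"
    and \<kappa>: "0 \<le> \<kappa>"
    and dom: "\<And>x g. g \<in> borel_measurable borel \<Longrightarrow>
      ennreal (exp (- \<kappa> * indicator B x)) * (\<integral>\<^sup>+r. g r \<partial>P x) \<le> (\<integral>\<^sup>+r. g r \<partial>P' x)"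
  shows "\<delta> * real t * exp (- \<kappa> * (\<integral>h. pulls B t h \<partial>history_law A P t))
    \<le> regret A \<mu> P t + regret A \<mu>' P' t"
proof -
  have P: "P \<in> borel \<rightarrow>\<^sub>M prob_algebra borel" and P': "P' \<in> borel \<rightarrow>\<^sub>M prob_algebra borel"
    using I I' by (auto simp: lipschitz_mab_instance_def)
  let ?M = "history_law A P t" and ?M' = "history_law A P' t" and ?N = "pulls B t"
  interpret prob_space ?M by (rule prob_space_history_law[OF A P])
  define m where "m = (\<integral>h. ?N h \<partial>?M)"
  note N[measurable] = borel_measurable_pulls[OF B, of t]
  \<comment> \<open>Gaps are nonnegative everywhere, so \<open>\<delta>\<close> times the indicator
    of \<open>B\<close>, or of its complement, lies below the respective gap on the whole
    space.\<close>
  have below: "\<mu> x \<le> (SUP x. \<mu> x)" "\<mu>' x \<le> (SUP x. \<mu>' x)" for x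
    using I I' by (auto simp: lipschitz_mab_instance_def intro!: cSUP_upper bdd_aboveI2[of _ _ 1])
  have Nc: "real t - ?N h = (\<Sum>s<t. indicator (- B) (fst (h s)))" for h
    unfolding pulls_def indicator_compl by (simp add: sum_subtractf)
  have R: "(\<integral>h. \<delta> * ?N h \<partial>?M) \<le> regret A \<mu> P t"
  proof -
    have "(\<integral>h. (\<Sum>s<t. \<delta> * indicator B (fst (h s))) \<partial>?M) \<le> regret A \<mu> P t"
      by (rule integral_gap_le_regret[OF A I])
        (use B \<delta> gap below(1) in \<open>auto simp: indicator_def\<close>)
    then show ?thesis by (simp only: pulls_def sum_distrib_left)
  qed
  have R': "(\<integral>h. \<delta> * (real t - ?N h) \<partial>?M') \<le> regret A \<mu>' P' t"
  proof -
    have "(\<integral>h. (\<Sum>s<t. \<delta> * indicator (- B) (fst (h s))) \<partial>?M') \<le> regret A \<mu>' P' t"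
      by (rule integral_gap_le_regret[OF A I'])
        (use B \<delta> gap' below(2) in \<open>auto simp: indicator_def\<close>)
    then show ?thesis by (simp only: Nc sum_distrib_left)
  qed
  have bN: "\<bar>\<delta> * (real t - ?N h)\<bar> \<le> \<delta> * real t" for h
    using \<delta> pulls_nonneg[of B t h] pulls_le[of B t h]
    by (simp add: abs_mult mult_left_mono)
  have pos: "0 \<le> \<delta> * (real t - ?N h)" for h
    using \<delta> pulls_le[of B t h] by simp
  have exp_le: "exp (- \<kappa> * ?N h) \<le> 1" for h
    using \<kappa> pulls_nonneg[of B t h] by simp
  have int': "integrable ?M' (\<lambda>h. \<delta> * (real t - ?N h))"
    by (rule integrable_history_law[OF A P' _ bN]) measurable
  have bE: "\<bar>\<delta> * (real t - ?N h) * exp (- \<kappa> * ?N h)\<bar> \<le> \<delta> * real t" for h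
  proof -
    have "\<bar>\<delta> * (real t - ?N h)\<bar> * exp (- \<kappa> * ?N h) \<le> \<bar>\<delta> * (real t - ?N h)\<bar> * 1"
      by (rule mult_left_mono[OF exp_le]) simp
    then show ?thesis using bN[of h] by (simp only: abs_mult[of _ "exp _"] abs_exp_cancel)
  qed
  have intE: "integrable ?M (\<lambda>h. \<delta> * (real t - ?N h) * exp (- \<kappa> * ?N h))"
    by (rule integrable_history_law[OF A P _ bE]) measurable
  \<comment> \<open>The weights of the single rounds collapse into a function of the pull count
    alone.\<close>
  have prod: "(\<Prod>s<t. ennreal (exp (- \<kappa> * indicator B (fst (h s))))) = ennreal (exp (- \<kappa> * ?N h))" for h
    by (subst prod_ennreal) (auto simp: pulls_def exp_sum[symmetric] sum_distrib_left)
  have "ennreal (\<integral>h. \<delta> * (real t - ?N h) * exp (- \<kappa> * ?N h) \<partial>?M) =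
      (\<integral>\<^sup>+h. ennreal (\<delta> * (real t - ?N h) * exp (- \<kappa> * ?N h)) \<partial>?M)"
    using pos by (intro nn_integral_eq_integral[symmetric] intE) (simp add: mult_nonneg_nonneg)
  also have "\<dots> = (\<integral>\<^sup>+h. ennreal (\<delta> * (real t - ?N h)) *
      (\<Prod>s<t. ennreal (exp (- \<kappa> * indicator B (fst (h s))))) \<partial>?M)"
    unfolding prod using pos by (simp add: ennreal_mult)
  also have "\<dots> \<le> (\<integral>\<^sup>+h. ennreal (\<delta> * (real t - ?N h)) \<partial>?M')"
    by (rule history_law_dominated[OF A P P' _ dom]) (use B N in simp_all)
  also have "\<dots> = ennreal (\<integral>h. \<delta> * (real t - ?N h) \<partial>?M')"
    using pos by (intro nn_integral_eq_integral int') simp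
  finally have change: "(\<integral>h. \<delta> * (real t - ?N h) * exp (- \<kappa> * ?N h) \<partial>?M) \<le>
      (\<integral>h. \<delta> * (real t - ?N h) \<partial>?M')"
    by (subst (asm) ennreal_le_iff) (rule Bochner_Integration.integral_nonneg[OF pos])
  have intN: "integrable ?M ?N"
    by (rule integrable_pulls[OF A P B])
  \<comment> \<open>Jensen by hand: the tangent of \<open>exp (- \<kappa> * N)\<close> at the mean
    \<open>m\<close> lies below the function, and its linear term integrates to 0.\<close>
  have "\<delta> * real t * exp (- \<kappa> * m) =
      (\<integral>h. \<delta> * real t * (exp (- \<kappa> * m) * (1 - \<kappa> * (?N h - m))) \<partial>?M)"
    using intN by (simp add: m_def[symmetric] prob_space)
  also have "\<dots> \<le> (\<integral>h. \<delta> * ?N h + \<delta> * (real t - ?N h) * exp (- \<kappa> * ?N h) \<partial>?M)"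
  proof (rule integral_mono)
    fix h
    have "exp (- \<kappa> * m) * (1 - \<kappa> * (?N h - m)) \<le> exp (- \<kappa> * m) * exp (- \<kappa> * (?N h - m))"
      using exp_ge_add_one_self[of "- \<kappa> * (?N h - m)"] by (intro mult_left_mono) auto
    also have "\<dots> = exp (- \<kappa> * ?N h)"
      by (simp add: exp_add[symmetric] algebra_simps)
    finally have "\<delta> * real t * (exp (- \<kappa> * m) * (1 - \<kappa> * (?N h - m))) \<le> \<delta> * real t * exp (- \<kappa> * ?N h)"
      using \<delta> by (intro mult_left_mono) auto
    also have "\<dots> = \<delta> * ?N h * exp (- \<kappa> * ?N h) + \<delta> * (real t - ?N h) * exp (- \<kappa> * ?N h)"
      by (simp add: algebra_simps)
    \<comment> \<open>Split \<open>t\<close> as \<open>N + (t - N)\<close>. The first share drops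
      its exponential and is paid for by \<open>R\<close>; the second is the integrand of
      \<open>change\<close>.\<close>
    also have "\<dots> \<le> \<delta> * ?N h * 1 + \<delta> * (real t - ?N h) * exp (- \<kappa> * ?N h)"
      using \<delta> pulls_nonneg[of B t h] by (intro add_right_mono mult_left_mono exp_le) auto
    finally show "\<delta> * real t * (exp (- \<kappa> * m) * (1 - \<kappa> * (?N h - m))) \<le>
        \<delta> * ?N h + \<delta> * (real t - ?N h) * exp (- \<kappa> * ?N h)"
      by simp
  qed (use intN intE in auto)
  also have "\<dots> = (\<integral>h. \<delta> * ?N h \<partial>?M) + (\<integral>h. \<delta> * (real t - ?N h) * exp (- \<kappa> * ?N h) \<partial>?M)"
    using intN intE by (intro Bochner_Integration.integral_add) auto
  also have "\<dots> \<le> regret A \<mu> P t + regret A \<mu>' P' t"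
    using R R' change by linarith
  finally show ?thesis by (simp add: m_def)
qed

section \<open>Separated points in an infinite metric space\<close>

lemma infinite_metric_space_separated_sequence:
  assumes inf: "infinite (UNIV :: 'a::metric_space set)"
  obtains x :: "nat \<Rightarrow> 'a::metric_space" and r :: "nat \<Rightarrow> real"
  where "\<And>n. 0 < r n" "\<And>m n. m \<noteq> n \<Longrightarrow> r n \<le> dist (x m) (x n)"
proof (cases "\<exists>p::'a. p islimpt UNIV")
  case True
  then obtain p :: 'a where p: "p islimpt UNIV" by blast
  have close: "\<exists>y. y \<noteq> p \<and> dist y p < e" if "0 < e" for e
    using p that by (auto simp: islimpt_approachable)
  \<comment> \<open>Points approach the limit point \<open>p\<close> so fast that each is less than
    half as far from \<open>p\<close> as its predecessor.\<close>
  have "\<exists>x::nat \<Rightarrow> 'a. \<forall>n. x n \<noteq> p \<and> dist (x (Suc n)) p < dist (x n) p / 2"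
  proof (rule dependent_nat_choice)
    show "\<exists>y. y \<noteq> p" using close[of 1] by auto
    show "\<exists>z. z \<noteq> p \<and> dist z p < dist y p / 2" if "y \<noteq> p" for y and n :: nat
      using close[of "dist y p / 2"] that by simp
  qed
  then obtain x where x: "\<And>n. x n \<noteq> p" and half: "\<And>n. dist (x (Suc n)) p < dist (x n) p / 2"
    by blast
  have decay: "dist (x n) p < dist (x m) p / 2" if "m < n" for m n
    using that
  proof (induction n rule: less_Suc_induct)
    case (1 i)
    then show ?case by (rule half)
  next
    case (2 i j k)
    then show ?case using zero_le_dist[of "x j" p] by linarith
  qed
  show ?thesis
  \<comment> \<open>Of two points, the nearer to \<open>p\<close> is less than half as far away as
    the other, so their mutual distance exceeds half the larger distance to
    \<open>p\<close>.\<close>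
  proof (rule that[of "\<lambda>n. dist (x n) p / 2" x])
    show "0 < dist (x n) p / 2" for n using x by simp
    show "dist (x n) p / 2 \<le> dist (x m) (x n)" if "m \<noteq> n" for m n
      using that decay[of m n] decay[of n m] dist_triangle[of "x m" p "x n"]
        dist_triangle[of "x n" p "x m"] zero_le_dist[of "x n" p] zero_le_dist[of "x m" p]
      by (cases "m < n") (auto simp: dist_commute)
  qed
next
  case False
  \<comment> \<open>Without limit points every point is isolated, so any injective sequence works
    with its isolation radii, which need not be bounded away from 0.\<close>
  have "\<exists>e>0. \<forall>z. z \<noteq> y \<longrightarrow> e \<le> dist z y" for y :: 'a
    using False by (force simp: islimpt_approachable not_less)
  then obtain e where e: "\<And>y::'a. 0 < e y" "\<And>y z. z \<noteq> y \<Longrightarrow> e y \<le> dist z y"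
    by metis
  obtain x :: "nat \<Rightarrow> 'a" where x: "inj x"
    using infinite_countable_subset[OF inf] by auto
  show ?thesis
    by (rule that[of "\<lambda>n. e (x n)" x]) (use e x in \<open>auto simp: inj_eq\<close>)
qed

section \<open>The base instance and its bumped variants\<close>

locale separated_sequence =
  fixes x :: "nat \<Rightarrow> 'a::metric_space" and r :: "nat \<Rightarrow> real"
  assumes r_pos: "0 < r n"
    and r_le_dist: "m \<noteq> n \<Longrightarrow> r n \<le> dist (x m) (x n)"
    and dist_le_1: "dist y (z::'a) \<le> 1"
begin

text \<open>The diameter bound enters here; it keeps all payoffs inside \<open>{0..1}\<close> and is
  used again to compare likelihoods.\<close>

lemma r_le_1: "r n \<le> 1"
  using r_le_dist[of "Suc n" n] dist_le_1[of "x (Suc n)" "x n"] by simp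

text \<open>A cone over the ball of radius \<open>r n\<close>, twice the radius of the bump. Hence
  its depth is still at least \<open>r n / 8\<close> throughout the ball of radius
  \<open>r n / 2\<close>.\<close>

definition dip :: "nat \<Rightarrow> 'a \<Rightarrow> real" where
  "dip n y = max 0 ((r n - dist y (x n)) / 4)"

text \<open>
  The point \<open>x 0\<close> gets no dip, so that the supremum \<open>1/2\<close> is attained.
\<close>

definition base :: "'a \<Rightarrow> real" where
  "base y = 1/2 - (SUP n. dip (Suc n) y)"

text \<open>
  The slopes \<open>1/4\<close> of the dips and \<open>3/4\<close> of the bump add up to \<open>1\<close>.
\<close>

definition bump :: "nat \<Rightarrow> 'a \<Rightarrow> real" where
  "bump n y = max 0 (3/4 * (r n / 2 - dist y (x n)))"

definition bumped :: "nat \<Rightarrow> 'a \<Rightarrow> real" where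
  "bumped n y = base y + bump n y"

lemma dip_nonneg: "0 \<le> dip n y"
  by (simp add: dip_def)

lemma dip_le: "dip n y \<le> 1/4"
  using r_le_1[of n] zero_le_dist[of y "x n"] unfolding dip_def
  by (intro max.boundedI divide_right_mono) linarith+

lemma bdd_above_dip: "bdd_above (range (\<lambda>n. dip (Suc n) y))"
  by (rule bdd_aboveI2[where M = "1/4"]) (rule dip_le)

lemma dip_lipschitz: "dip n y \<le> dip n z + dist y z / 4"
  using dist_triangle[of z "x n" y] by (auto simp: dip_def dist_commute max_def field_simps)

lemma base_le_half: "base y \<le> 1/2"
  using order_trans[OF dip_nonneg cSUP_upper[OF UNIV_I bdd_above_dip, of 0 y]]
  by (simp add: base_def)

lemma base_ge: "1/4 \<le> base y"
  using cSUP_least[of UNIV "\<lambda>n. dip (Suc n) y" "1/4"] dip_le by (simp add: base_def)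

text \<open>The cones may overlap, but a supremum of functions with Lipschitz constant
  \<open>1/4\<close> keeps that constant, which a sum might not.\<close>

lemma base_lipschitz: "\<bar>base y - base z\<bar> \<le> dist y z / 4"
proof -
  have "(SUP n. dip (Suc n) y) \<le> (SUP n. dip (Suc n) z) + dist y z / 4" for y z
  proof (rule cSUP_least)
    fix n
    show "dip (Suc n) y \<le> (SUP n. dip (Suc n) z) + dist y z / 4"
      using dip_lipschitz[of "Suc n" y z] cSUP_upper[OF UNIV_I bdd_above_dip, of n z] by linarith
  qed simp
  from this[of y z] this[of z y] show ?thesis
    unfolding base_def dist_commute[of z y] by linarith
qed

lemma dip_other_center: "m \<noteq> n \<Longrightarrow> dip n (x m) = 0"
  using r_le_dist[of m n] by (simp add: dip_def)

lemma base_center_0: "base (x 0) = 1/2"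
  by (simp add: base_def dip_other_center)

text \<open>By separation no foreign dip reaches \<open>x n\<close>, so at most its own dip, of
  depth \<open>r n / 4\<close>, counts there.\<close>

lemma base_center_ge: "1/2 - r n / 4 \<le> base (x n)"
proof -
  have "(SUP m. dip (Suc m) (x n)) \<le> r n / 4"
  proof (rule cSUP_least)
    fix m show "dip (Suc m) (x n) \<le> r n / 4"
      using r_pos[of n] dip_other_center[of n "Suc m"]
      by (cases "n = Suc m") (auto simp: dip_def)
  qed simp
  then show ?thesis by (simp add: base_def)
qed

lemma SUP_base: "(SUP y. base y) = 1/2"
proof (rule cSup_eq_maximum)
  show "1/2 \<in> range base" using base_center_0 by (metis rangeI)
  show "z \<le> 1/2" if "z \<in> range base" for z
    using that base_le_half by blast
qed

lemma base_gap:
  assumes "y \<in> ball (x (Suc n)) (r (Suc n) / 2)"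
  shows "r (Suc n) / 8 \<le> 1/2 - base y"
proof -
  have "r (Suc n) / 8 \<le> dip (Suc n) y"
    using assms by (auto simp: dip_def dist_commute max_def field_simps)
  also have "\<dots> \<le> (SUP n. dip (Suc n) y)"
    by (rule cSUP_upper[OF UNIV_I bdd_above_dip])
  finally show ?thesis by (simp add: base_def)
qed

lemma bumped_outside: "y \<notin> ball (x n) (r n / 2) \<Longrightarrow> bumped n y = base y"
  by (simp add: bumped_def bump_def dist_commute)

lemma bumped_bounds:
  shows "base y \<le> bumped n y" and "bumped n y \<le> base y + 3/8 * r n"
  using r_pos[of n] zero_le_dist[of y "x n"] by (auto simp: bumped_def bump_def max_def field_simps)

lemma bump_lipschitz: "\<bar>bump n y - bump n z\<bar> \<le> 3/4 * dist y z"
  using dist_triangle[of y "x n" z] dist_triangle[of z "x n" y]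
  by (auto simp: bump_def dist_commute max_def field_simps abs_le_iff)

lemma bumped_lipschitz: "\<bar>bumped n y - bumped n z\<bar> \<le> dist y z"
  using bump_lipschitz[of n y z] base_lipschitz[of y z] unfolding bumped_def by linarith

lemma bumped_range: "0 \<le> bumped n y" "bumped n y \<le> 1"
  using bumped_bounds[where n = n and y = y] base_ge[of y] base_le_half[of y] r_le_1[of n] by linarith+

lemma bumped_gap:
  assumes "y \<notin> ball (x n) (r n / 2)"
  shows "r n / 8 \<le> (SUP y. bumped n y) - bumped n y"
proof -
  \<comment> \<open>At its centre the bump has height \<open>3/8 * r n\<close>, which exceeds the
    dip of depth at most \<open>r n / 4\<close> by \<open>r n / 8\<close>.\<close>
  have "1/2 + r n / 8 \<le> bumped n (x n)"
    using base_center_ge[of n] r_pos[of n] by (simp add: bumped_def bump_def)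
  also have "\<dots> \<le> (SUP y. bumped n y)"
    by (rule cSUP_upper) (auto intro!: bdd_aboveI2[of _ _ 1] bumped_range)
  finally show ?thesis
    using bumped_outside[OF assms] base_le_half[of y] by simp
qed

lemma instance_base: "lipschitz_mab_instance base (bernoulli_reward base)"
proof (rule lipschitz_mab_instance_bernoulli_reward)
  show "0 \<le> base y" "base y \<le> 1" for y
    using base_ge[of y] base_le_half[of y] by linarith+
  show "\<bar>base y - base z\<bar> \<le> dist y z" for y z
    using base_lipschitz[of y z] zero_le_dist[of y z] by linarith
qed

lemma instance_bumped: "lipschitz_mab_instance (bumped n) (bernoulli_reward (bumped n))"
  by (rule lipschitz_mab_instance_bernoulli_reward) (rule bumped_range bumped_lipschitz)+

text \<open>The bump only makes a reward of 1 likelier, so the mass at 0 is what matters. It is at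
  least \<open>1/2\<close> under \<open>base\<close> and drops by at most \<open>3/8 * r n\<close>,
  hence keeps at least the fraction \<open>1 - 3/4 * r n\<close>.\<close>

lemma bumped_dominates_base:
  assumes g: "g \<in> borel_measurable borel"
  shows "ennreal (exp (- (3 * r n) * indicator (ball (x n) (r n / 2)) y)) *
      (\<integral>\<^sup>+s. g s \<partial>bernoulli_reward base y) \<le> (\<integral>\<^sup>+s. g s \<partial>bernoulli_reward (bumped n) y)"
proof (rule nn_integral_bernoulli_reward_mono)
  let ?c = "exp (- (3 * r n) * indicator (ball (x n) (r n / 2)) y) :: real"
  show range: "0 \<le> base y" "base y \<le> 1"
    using base_ge[of y] base_le_half[of y] by linarith+
  show "0 \<le> bumped n y" "bumped n y \<le> 1" by (rule bumped_range)+
  have c: "?c \<le> 1" using r_pos[of n] by (simp add: indicator_def)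
  then have "?c * base y \<le> 1 * base y"
    using range by (intro mult_right_mono)
  then show "?c * base y \<le> bumped n y" using bumped_bounds(1)[where n = n and y = y] by simp
  show "?c * (1 - base y) \<le> 1 - bumped n y"
  proof (cases "y \<in> ball (x n) (r n / 2)")
    case True
    \<comment> \<open>The product equals \<open>1 + 9/4 * r n * (1 - r n)\<close>. With
      \<open>1 + 3 * r n \<le> exp (3 * r n)\<close> this makes \<open>exp (- (3 * r n))\<close>
      small enough.\<close>
    have "1 \<le> (1 + 3 * r n) * (1 - 3/4 * r n)"
    proof -
      have "0 \<le> r n * (1 - r n)"
        using r_pos[of n] r_le_1[of n] by simp
      then show ?thesis by (simp add: algebra_simps)
    qed
    also have "\<dots> \<le> exp (3 * r n) * (1 - 3/4 * r n)"
      using exp_ge_add_one_self[of "3 * r n"] r_le_1[of n] by (intro mult_right_mono) auto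
    finally have "exp (- (3 * r n)) \<le> 1 - 3/4 * r n"
      by (simp add: exp_minus field_simps)
    then have "?c * (1 - base y) \<le> (1 - 3/4 * r n) * (1 - base y)"
      using True range by (intro mult_right_mono) auto
    also have "\<dots> = 1 - base y - 3/4 * r n * (1 - base y)"
      by (simp add: algebra_simps)
    also have "\<dots> \<le> 1 - base y - 3/4 * r n * (1/2)"
      using base_le_half[of y] r_pos[of n] by (intro diff_left_mono mult_left_mono) auto
    also have "\<dots> \<le> 1 - bumped n y"
      using bumped_bounds(2)[where n = n and y = y] by simp
    finally show ?thesis .
  next
    case False
    then show ?thesis by (simp add: bumped_outside)
  qed
qed (use g in auto)

section \<open>Regret of the base instance from pulls in the balls\<close>

lemma disjoint_balls:
  assumes "m \<noteq> n"
  shows "ball (x m) (r m / 2) \<inter> ball (x n) (r n / 2) = {}"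
proof -
  have False if "dist (x m) y < r m / 2" "dist (x n) y < r n / 2" for y
    using that r_le_dist[of m n] r_le_dist[of n m] assms dist_triangle2[of "x m" "x n" y]
    by (simp add: dist_commute)
  then show ?thesis by auto
qed

text \<open>The balls are disjoint, so a round is charged for at most one \<open>n\<close>, and that
  charge is covered by \<open>base_gap\<close>. The costs for different \<open>n\<close> therefore
  add up.\<close>

lemma sum_pulls_le_regret:
  assumes A: "mab_algorithm A"
  shows "(\<Sum>n<k. r (Suc n) / 8 *
      (\<integral>h. pulls (ball (x (Suc n)) (r (Suc n) / 2)) t h \<partial>history_law A (bernoulli_reward base) t))
    \<le> regret A base (bernoulli_reward base) t"
proof -
  let ?M = "history_law A (bernoulli_reward base) t"
  let ?B = "\<lambda>n. ball (x (Suc n)) (r (Suc n) / 2)"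
  let ?\<phi> = "\<lambda>y. \<Sum>n<k. r (Suc n) / 8 * indicator (?B n) y"
  have P: "bernoulli_reward base \<in> borel \<rightarrow>\<^sub>M prob_algebra borel"
    using instance_base by (simp add: lipschitz_mab_instance_def)
  have int: "integrable ?M (pulls (?B n) t)" for n
    by (rule integrable_pulls[OF A P]) simp
  have "(\<Sum>n<k. r (Suc n) / 8 * (\<integral>h. pulls (?B n) t h \<partial>?M)) =
      (\<integral>h. (\<Sum>n<k. r (Suc n) / 8 * pulls (?B n) t h) \<partial>?M)"
    using int by simp
  also have "\<dots> = (\<integral>h. (\<Sum>s<t. ?\<phi> (fst (h s))) \<partial>?M)"
    unfolding pulls_def sum_distrib_left by (subst sum.swap) (rule refl)
  also have "\<dots> \<le> regret A base (bernoulli_reward base) t"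
  proof (rule integral_gap_le_regret[OF A instance_base])
    show "?\<phi> \<in> borel_measurable borel"
      by (intro borel_measurable_sum borel_measurable_times borel_measurable_indicator) auto
    show "0 \<le> ?\<phi> y" for y
      using r_pos by (intro sum_nonneg mult_nonneg_nonneg) (auto simp: less_imp_le)
    show "?\<phi> y \<le> (SUP y. base y) - base y" for y
    proof (cases "\<exists>n<k. y \<in> ?B n")
      case True
      then obtain n where n: "n < k" "y \<in> ?B n" by blast
      have "y \<notin> ?B m" if "m \<noteq> n" for m
        using n(2) disjoint_balls[of "Suc m" "Suc n"] that by blast
      then have "?\<phi> y = (\<Sum>m<k. if m = n then r (Suc n) / 8 else 0)"
        using n by (intro sum.cong) (auto simp: indicator_def)
      also have "\<dots> = r (Suc n) / 8" using n by simp
      finally show ?thesis using base_gap[OF n(2)] by (simp add: SUP_base)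
    next
      case False
      then have "?\<phi> y = 0" by (intro sum.neutral) (auto simp: indicator_def)
      then show ?thesis using base_le_half[of y] by (simp add: SUP_base)
    qed
  qed
  finally show ?thesis .
qed

text \<open>With fewer expected pulls, \<open>regret_sum_ge\<close> would force the two regrets to
  add up to order \<open>sqrt t\<close>, which eventually exceeds \<open>(C + C') * ln t\<close>.
  How large \<open>t\<close> must be may depend on \<open>n\<close>.\<close>

lemma eventually_many_pulls:
  assumes A: "mab_algorithm A"
    and C: "\<And>t. 2 \<le> t \<Longrightarrow> regret A base (bernoulli_reward base) t \<le> C * ln (real t)"
    and C': "\<And>t. 2 \<le> t \<Longrightarrow>
      regret A (bumped (Suc n)) (bernoulli_reward (bumped (Suc n))) t \<le> C' * ln (real t)"
  shows "\<forall>\<^sub>F t in sequentially. ln (real t) / 2 \<le> 3 * r (Suc n) *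
    (\<integral>h. pulls (ball (x (Suc n)) (r (Suc n) / 2)) t h \<partial>history_law A (bernoulli_reward base) t)"
proof -
  have "0 < r (Suc n) / 8" using r_pos by simp
  \<comment> \<open>The denominator is \<open>sqrt t\<close>; the exponent \<open>ln t / 2\<close>
    is the threshold for \<open>3 * r (Suc n)\<close> times the expected pulls.\<close>
  have "(\<lambda>t. (C + C') * (ln (real t) / (real t * exp (- (ln (real t) / 2))))) \<longlonglongrightarrow> (C + C') * 0"
    by (rule tendsto_mult_left) real_asymp
  then have "\<forall>\<^sub>F t in sequentially.
      (C + C') * (ln (real t) / (real t * exp (- (ln (real t) / 2)))) < r (Suc n) / 8"
    using \<open>0 < r (Suc n) / 8\<close> by (intro order_tendstoD(2)[of _ 0]) simp_all
  then show ?thesis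
    using eventually_ge_at_top[of 2]
  proof eventually_elim
    case (elim t)
    let ?B = "ball (x (Suc n)) (r (Suc n) / 2)"
    let ?m = "\<integral>h. pulls ?B t h \<partial>history_law A (bernoulli_reward base) t"
    have "r (Suc n) / 8 * real t * exp (- (3 * r (Suc n)) * ?m) \<le>
        regret A base (bernoulli_reward base) t +
        regret A (bumped (Suc n)) (bernoulli_reward (bumped (Suc n))) t"
      by (rule regret_sum_ge[OF A instance_base instance_bumped _ _ _ bumped_gap _ bumped_dominates_base])
        (use r_pos[of "Suc n"] base_gap[of _ n] in \<open>auto simp: SUP_base\<close>)
    also have "\<dots> \<le> (C + C') * ln (real t)"
      using C C' elim by (simp add: distrib_right add_mono)
    also have "\<dots> < r (Suc n) / 8 * real t * exp (- (ln (real t) / 2))"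
      using elim by (simp add: divide_less_eq mult.assoc)
    finally have "exp (- (3 * r (Suc n)) * ?m) < exp (- (ln (real t) / 2))"
      using r_pos[of "Suc n"] elim by (subst (asm) mult_less_cancel_left_pos) auto
    then show ?case by simp
  qed
qed

end

section \<open>Adding up the contributions of many balls\<close>

theorem theorem1p7:
  assumes "infinite (UNIV :: 'a::metric_space set)"
    and "\<forall>x y :: 'a. dist x y \<le> 1"
  shows "\<not> lipschitz_mab_tractable TYPE('a) (\<lambda>t. ln (real t))"
proof
  assume "lipschitz_mab_tractable TYPE('a) (\<lambda>t. ln (real t))"
  then obtain A :: "'a mab_algorithm" where A: "mab_algorithm A"
    and log_regret: "\<And>\<mu> P. lipschitz_mab_instance \<mu> P \<Longrightarrow>
      \<exists>C. \<forall>t\<ge>2. regret A \<mu> P t \<le> C * ln (real t)"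
    by (auto simp: lipschitz_mab_tractable_def)
  obtain x :: "nat \<Rightarrow> 'a" and r :: "nat \<Rightarrow> real"
    where "\<And>n. 0 < r n" "\<And>m n. m \<noteq> n \<Longrightarrow> r n \<le> dist (x m) (x n)"
    by (rule infinite_metric_space_separated_sequence[OF assms(1)]) (rule that)
  then interpret separated_sequence x r
    using assms(2) by unfold_locales auto
  obtain C where C: "\<And>t. 2 \<le> t \<Longrightarrow> regret A base (bernoulli_reward base) t \<le> C * ln (real t)"
    using log_regret[OF instance_base] by blast
  define m where "m = (\<lambda>n t. \<integral>h. pulls (ball (x (Suc n)) (r (Suc n) / 2)) t h
    \<partial>history_law A (bernoulli_reward base) t)"
  \<comment> \<open>The constant for the bumped instance depends on \<open>n\<close>, but it affects
    only how large \<open>t\<close> must be, not the bound itself.\<close>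
  have many: "\<forall>\<^sub>F t in sequentially. ln (real t) / 2 \<le> 3 * r (Suc n) * m n t" for n
    using log_regret[OF instance_bumped[of "Suc n"]] eventually_many_pulls[OF A C]
    unfolding m_def by blast
  \<comment> \<open>Each ball contributes at least \<open>ln t / 48\<close>, where
    \<open>48 = 2 * 3 * 8\<close>. Since \<open>C\<close> belongs to the base instance alone,
    \<open>k\<close> can be chosen after it.\<close>
  obtain k :: nat where k: "48 * C < real k"
    using reals_Archimedean2 by blast
  \<comment> \<open>Only finitely many \<open>n\<close> are involved, so a single \<open>t\<close>
    serves them all.\<close>
  have "\<forall>\<^sub>F t in sequentially.
      2 \<le> t \<and> (\<forall>n\<in>{..<k}. ln (real t) / 2 \<le> 3 * r (Suc n) * m n t)"
    using many by (intro eventually_conj eventually_ge_at_top eventually_ball_finite) auto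
  then obtain t :: nat where t: "2 \<le> t"
    and mt: "\<And>n. n < k \<Longrightarrow> ln (real t) / 2 \<le> 3 * r (Suc n) * m n t"
    by (auto dest: eventually_happens)
  have "real k * (ln (real t) / 48) = (\<Sum>n<k. ln (real t) / 48)"
    by simp
  also have "\<dots> \<le> (\<Sum>n<k. r (Suc n) / 8 * m n t)"
    by (intro sum_mono) (use mt in force)
  also have "\<dots> \<le> C * ln (real t)"
    using order_trans[OF sum_pulls_le_regret[OF A] C[OF t]] unfolding m_def .
  finally have "real k * ln (real t) \<le> 48 * C * ln (real t)"
    by simp
  moreover have "0 < ln (real t)" using t by simp
  ultimately show False using k by simp
qed

end
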